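(* As formal power series, $$A(t,x,y)=\frac{(t-1)\,xy\,e^{(t-1)xy}}{t-e^{(t-1)x(1+y)}}.$$
   Context: For $n\ge1$, $0\le d\le n-1$, $1\le j\le n$, $A(n,d,j)$ is the number of permutations $\pi_1\cdots\pi_n$ of $\{1,\dots,n\}$ with exactly $d$ descents (positions $i\in\{1,\dots,n-1\}$ with $\pi_i>\pi_{i+1}$) and first letter $\pi_1=j$; $A(n,d,j)=0$ for all other $n,d,j$. Define $$A(t,x,y)=\sum_{n\ge1}\sum_{d\ge0}\sum_{j=1}^{n}\frac{A(n,d,j)\,t^dx^ny^j}{(j-1)!\,(n-j)!}.$$ The right-hand side of the identity is expanded as a power series in $x,y$ with coefficients in $\mathbb Q(t)$. *)

theory Defs
  imports
    "HOL-Combinatorics.Permutations"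
    "HOL-Computational_Algebra.Formal_Power_Series"
    "HOL-Computational_Algebra.Polynomial_Factorial"
begin

definition descents :: "nat \<Rightarrow> (nat \<Rightarrow> nat) \<Rightarrow> nat set" where
  "descents n \<pi> = {i \<in> {1..<n}. \<pi> i > \<pi> (i + 1)}"

definition A_num :: "nat \<Rightarrow> nat \<Rightarrow> nat \<Rightarrow> nat" where
  "A_num n d j =
     (if 1 \<le> n \<and> d \<le> n - 1 \<and> 1 \<le> j \<and> j \<le> n
      then card {\<pi>. \<pi> permutes {1..n} \<and> card (descents n \<pi>) = d \<and> \<pi> 1 = j}
      else 0)"

text \<open>
  The ring of power series in \<open>x\<close> and \<open>y\<close> over \<open>\<rat>(t)\<close> is represented as \<open>\<rat>(t)[[y]][[x]]\<close>:
  the outer series variable is \<open>x\<close>, the inner one is \<open>y\<close>, and \<open>\<rat>(t)\<close> is the fraction field of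
  the polynomial ring \<open>\<rat>[t]\<close>.
\<close>

type_synonym ratfun = "rat poly fract"
type_synonym series = "ratfun fps fps"

definition t_ratfun :: ratfun where
  "t_ratfun = to_fract [:0, 1:]"

definition T :: series where
  "T = fps_const (fps_const t_ratfun)"

definition X :: series where
  "X = fps_X"

definition Y :: series where
  "Y = fps_const fps_X"

text \<open>
  The library's \<open>fps_exp\<close> needs coefficients in a field, which \<open>\<rat>(t)[[y]]\<close> is not. The exponential
  is therefore the composition of \<open>\<Sum>k. z^k / k!\<close> with \<open>F\<close>; it is meaningful only if \<open>F\<close> is
  divisible by \<open>x\<close>.
\<close>

definition exp_series :: "series \<Rightarrow> series" where
  "exp_series F = Abs_fps (\<lambda>k. fps_const (1 / of_nat (fact k))) oo F"

text \<open>
  The coefficient of \<open>x^n\<close> is given as a series (in fact a polynomial) in \<open>y\<close>. The sum over all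
  \<open>d \<ge> 0\<close> stops at \<open>d < n\<close> because \<open>A_num n d j = 0\<close> for \<open>d \<ge> n\<close>; for \<open>n = 0\<close> it is empty.
\<close>

definition A_gf :: series where
  "A_gf = Abs_fps (\<lambda>n. \<Sum>d<n. \<Sum>j=1..n.
     fps_const (of_nat (A_num n d j) * t_ratfun ^ d / of_nat (fact (j - 1) * fact (n - j))) * fps_X ^ j)"

text \<open>
  As \<open>\<rat>(t)[[y]]\<close> is not a field, division by an outer series is well behaved only if its constant
  coefficient in \<open>x\<close> is a unit; for the denominator \<open>t - e^((t-1)x(1+y))\<close> that is \<open>t - 1\<close>.
\<close>

lemma t_ratfun_neq_1: "t_ratfun \<noteq> 1"
  unfolding t_ratfun_def by (metis to_fract_1 to_fract_eq_iff one_pCons pCons_eq_iff zero_neq_one)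

lemma denominator_nth_0:
  "fps_nth (T - exp_series ((T - 1) * X * (1 + Y))) 0 = fps_const (t_ratfun - 1)"
  by (simp add: exp_series_def T_def flip: fps_const_sub)

lemma divide_denominator_mult:
  fixes N :: series
  defines "D \<equiv> T - exp_series ((T - 1) * X * (1 + Y))"
  shows "N / D * D = N"
proof -
  have d0: "fps_nth D 0 = fps_const (t_ratfun - 1)"
    unfolding D_def by (rule denominator_nth_0)
  have ne: "fps_nth D 0 \<noteq> 0"
    using t_ratfun_neq_1 d0 by simp
  have u: "inverse (fps_nth D 0) * fps_nth D 0 = 1"
    by (rule inverse_mult_eq_1) (use t_ratfun_neq_1 d0 in simp)
  have "inverse D * D = 1"
    using fps_left_inverse'[OF u, of "inverse (fps_nth D 0)"] u
    by (simp add: fps_inverse_def[of D] mult.commute)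
  then show ?thesis
    using ne by (simp add: fps_divide_unit mult.assoc)
qed

end

theory Submission
  imports Defs
begin

unbundle fps_syntax

text \<open>
  Let \<open>f(n,j) = \<Sum>\<^sub>d A(n,d,j) t^d\<close>. Deleting the first letter \<open>j\<close> of a permutation of \<open>{1..n+1}\<close>
  removes a descent exactly when the next letter \<open>i\<close> of the standardised remainder satisfies \<open>i < j\<close>, so
  \<open>f(n+1,j)\<close> is the sum of \<open>t f(n,i)\<close> over \<open>i < j\<close> and of \<open>f(n,i)\<close> over \<open>i \<ge> j\<close>. Hence
  \<open>f(n+1,j+1) - f(n+1,j) = (t-1) f(n,j)\<close> and \<open>f(n+1,n+1) = t f(n+1,1)\<close> for \<open>n \<ge> 1\<close>.
  The first relation expresses every \<open>f(n,j)\<close> through the numbers \<open>f(m,1)\<close>, which gives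
  \<open>A = x y e^((t-1)xy) H(x(1+y))\<close> with \<open>H(z) = \<Sum>\<^sub>m f(m+1,1) z^m / m!\<close>; substituting this expression
  into the second relation gives \<open>H(z) (t - e^((t-1)z)) = t - 1\<close>.
\<close>

section \<open>Inserting and deleting the first letter\<close>

definition cons_perm :: "nat \<Rightarrow> (nat \<Rightarrow> nat) \<Rightarrow> nat \<Rightarrow> nat" where
  "cons_perm j \<sigma> i =
     (if i = 0 then 0 else if i = 1 then j
      else if \<sigma> (i - 1) < j then \<sigma> (i - 1) else Suc (\<sigma> (i - 1)))"

text \<open>At 0 the general clause would read the deleted letter \<open>\<pi> 1\<close>, so this
  point is fixed separately. For \<open>\<pi>\<close> permuting \<open>{1..Suc n}\<close> with
  \<open>\<pi> 1 = j\<close>, points beyond \<open>n\<close> are fixed because their images exceed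
  \<open>j\<close> and are lowered by one.\<close>

definition tl_perm :: "nat \<Rightarrow> (nat \<Rightarrow> nat) \<Rightarrow> nat \<Rightarrow> nat" where
  "tl_perm j \<pi> i =
     (if i = 0 then 0 else if \<pi> (Suc i) < j then \<pi> (Suc i) else \<pi> (Suc i) - 1)"

lemma permutesI_inj:
  assumes "finite S" "inj_on p S" "p ` S \<subseteq> S" "\<And>x. x \<notin> S \<Longrightarrow> p x = x"
  shows "p permutes S"
  using assms by (intro bij_imp_permutes) (simp_all add: bij_betw_def endo_inj_surj)

lemma cons_perm_permutes:
  assumes \<sigma>: "\<sigma> permutes {1..n}" and j: "j \<in> {1..Suc n}"
  shows "cons_perm j \<sigma> permutes {1..Suc n}"
proof (rule permutesI_inj)
  have inj: "\<sigma> x = \<sigma> y \<longleftrightarrow> x = y" for x y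
    using permutes_inj[OF \<sigma>] by (auto dest: injD)
  show "inj_on (cons_perm j \<sigma>) {1..Suc n}"
  proof (rule inj_onI)
    fix x y
    assume "x \<in> {1..Suc n}" "y \<in> {1..Suc n}" "cons_perm j \<sigma> x = cons_perm j \<sigma> y"
    then show "x = y"
      using inj[of "x - 1" "y - 1"] by (auto simp: cons_perm_def split: if_splits)
  qed
  show "cons_perm j \<sigma> ` {1..Suc n} \<subseteq> {1..Suc n}"
  proof (rule image_subsetI)
    fix x assume "x \<in> {1..Suc n}"
    then show "cons_perm j \<sigma> x \<in> {1..Suc n}"
      using permutes_in_image[OF \<sigma>, of "x - 1"] j by (auto simp: cons_perm_def)
  qed
  show "cons_perm j \<sigma> x = x" if "x \<notin> {1..Suc n}" for x
    using that permutes_not_in[OF \<sigma>, of "x - 1"] j by (cases x) (auto simp: cons_perm_def)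
qed simp

lemma tl_perm_permutes:
  assumes \<pi>: "\<pi> permutes {1..Suc n}" and j: "\<pi> 1 = j"
  shows "tl_perm j \<pi> permutes {1..n}"
proof (rule permutesI_inj)
  have inj: "\<pi> x = \<pi> y \<longleftrightarrow> x = y" for x y
    using permutes_inj[OF \<pi>] by (auto dest: injD)
  \<comment> \<open>The value \<open>j\<close> is missing after position 1, so lowering the larger
    values keeps all values distinct.\<close>
  have ne: "\<pi> (Suc x) \<noteq> j" if "x \<noteq> 0" for x
    using inj[of "Suc x" 1] that j by simp
  have range: "j \<in> {1..Suc n}"
    using permutes_in_image[OF \<pi>, of 1] j by simp
  show "inj_on (tl_perm j \<pi>) {1..n}"
  proof (rule inj_onI)
    fix x y
    assume "x \<in> {1..n}" "y \<in> {1..n}" "tl_perm j \<pi> x = tl_perm j \<pi> y"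
    then show "x = y"
      using inj[of "Suc x" "Suc y"] ne[of x] ne[of y] by (auto simp: tl_perm_def split: if_splits)
  qed
  show "tl_perm j \<pi> ` {1..n} \<subseteq> {1..n}"
  proof (rule image_subsetI)
    fix x assume "x \<in> {1..n}"
    then show "tl_perm j \<pi> x \<in> {1..n}"
      using permutes_in_image[OF \<pi>, of "Suc x"] ne[of x] range by (auto simp: tl_perm_def)
  qed
  show "tl_perm j \<pi> x = x" if "x \<notin> {1..n}" for x
    using that permutes_not_in[OF \<pi>, of "Suc x"] range by (auto simp: tl_perm_def)
qed simp

lemma bij_betw_cons_perm:
  assumes j: "j \<in> {1..Suc n}"
  shows "bij_betw (cons_perm j) {\<sigma>. \<sigma> permutes {1..n}} {\<pi>. \<pi> permutes {1..Suc n} \<and> \<pi> 1 = j}"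
proof (rule bij_betw_byWitness[where f' = "tl_perm j"])
  show "\<forall>\<sigma>\<in>{\<sigma>. \<sigma> permutes {1..n}}. tl_perm j (cons_perm j \<sigma>) = \<sigma>"
  proof clarify
    fix \<sigma> assume \<sigma>: "\<sigma> permutes {1..n}"
    show "tl_perm j (cons_perm j \<sigma>) = \<sigma>"
      using permutes_not_in[OF \<sigma>, of 0] by (auto simp: fun_eq_iff tl_perm_def cons_perm_def)
  qed
  show "\<forall>\<pi>\<in>{\<pi>. \<pi> permutes {1..Suc n} \<and> \<pi> 1 = j}. cons_perm j (tl_perm j \<pi>) = \<pi>"
  proof clarify
    fix \<pi> assume \<pi>: "\<pi> permutes {1..Suc n}" and j: "j = \<pi> 1"
    \<comment> \<open>A later letter equal to the first would be lowered below it by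
      \<open>tl_perm\<close> and never raised again.\<close>
    have ne: "\<pi> x \<noteq> \<pi> 1" if "x \<noteq> 1" for x
      using permutes_inj[OF \<pi>] that by (auto dest: injD)
    show "cons_perm (\<pi> 1) (tl_perm (\<pi> 1) \<pi>) = \<pi>"
    proof
      fix x
      show "cons_perm (\<pi> 1) (tl_perm (\<pi> 1) \<pi>) x = \<pi> x"
        using permutes_not_in[OF \<pi>, of 0] ne[of x]
        by (cases "x \<le> 1") (auto simp: tl_perm_def cons_perm_def le_Suc_eq)
    qed
  qed
  show "cons_perm j ` {\<sigma>. \<sigma> permutes {1..n}} \<subseteq> {\<pi>. \<pi> permutes {1..Suc n} \<and> \<pi> 1 = j}"
    using cons_perm_permutes[OF _ j] by (auto simp: cons_perm_def)
  show "tl_perm j ` {\<pi>. \<pi> permutes {1..Suc n} \<and> \<pi> 1 = j} \<subseteq> {\<sigma>. \<sigma> permutes {1..n}}"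
    using tl_perm_permutes by blast
qed

section \<open>Descents under insertion, and recurrences for \<open>f(n,j)\<close>\<close>

lemma finite_descents: "finite (descents n \<pi>)"
  by (simp add: descents_def)

lemma card_descents_less: "n \<ge> 1 \<Longrightarrow> card (descents n \<pi>) < n"
  using card_mono[of "{1..<n}" "descents n \<pi>"] by (force simp: descents_def)

text \<open>Making room for \<open>j\<close> preserves the relative order of the old letters, so
  their descents only shift by one. The one new comparison is between \<open>j\<close> and the
  second letter, which is smaller exactly when \<open>\<sigma> 1 < j\<close>.\<close>

lemma card_descents_cons_perm:
  assumes n: "n \<ge> 1"
  shows "card (descents (Suc n) (cons_perm j \<sigma>)) =
    card (descents n \<sigma>) + (if \<sigma> 1 < j then 1 else 0)"
proof -
  have "descents (Suc n) (cons_perm j \<sigma>) = (if \<sigma> 1 < j then {1} else {}) \<union> Suc ` descents n \<sigma>"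
  proof (rule set_eqI)
    fix i
    consider "i = 0" | "i = 1" | k where "i = Suc k" "k \<ge> 1"
      by (metis One_nat_def not0_implies_Suc less_one not_le)
    then show "i \<in> descents (Suc n) (cons_perm j \<sigma>) \<longleftrightarrow>
      i \<in> (if \<sigma> 1 < j then {1} else {}) \<union> Suc ` descents n \<sigma>"
      by cases (use n in \<open>auto simp: descents_def cons_perm_def inj_image_mem_iff image_iff\<close>)
  qed
  moreover have "1 \<notin> Suc ` descents n \<sigma>"
    by (auto simp: descents_def)
  ultimately show ?thesis
    by (simp add: card_image finite_descents)
qed

text \<open>This is \<open>f(n,j)\<close> of the overview, evaluated at an element of any
  commutative ring; \<open>sum_A_num\<close> links it to \<open>A_num\<close>.\<close>

definition descent_poly :: "'a::comm_ring_1 \<Rightarrow> nat \<Rightarrow> nat \<Rightarrow> 'a" where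
  "descent_poly t n j = (\<Sum>\<pi> | \<pi> permutes {1..n} \<and> \<pi> 1 = j. t ^ card (descents n \<pi>))"

lemma descent_poly_Suc:
  fixes t :: "'a::comm_ring_1"
  assumes n: "n \<ge> 1" and j: "j \<in> {1..Suc n}"
  shows "descent_poly t (Suc n) j = (\<Sum>i=1..n. (if i < j then t else 1) * descent_poly t n i)"
proof -
  let ?P = "{\<sigma>. \<sigma> permutes {1..n}}"
  have fin: "finite ?P"
    by (simp add: finite_permutations)
  have "descent_poly t (Suc n) j = (\<Sum>\<sigma>\<in>?P. t ^ card (descents (Suc n) (cons_perm j \<sigma>)))"
    unfolding descent_poly_def
    using sum.reindex_bij_betw[OF bij_betw_cons_perm[OF j], of "\<lambda>\<pi>. t ^ card (descents (Suc n) \<pi>)"]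
    by simp
  also have "\<dots> = (\<Sum>\<sigma>\<in>?P. (if \<sigma> 1 < j then t else 1) * t ^ card (descents n \<sigma>))"
    by (intro sum.cong) (auto simp: card_descents_cons_perm[OF n])
  \<comment> \<open>Group by the first letter of the remainder, which lies in \<open>{1..n}\<close>
    because \<open>n \<ge> 1\<close>.\<close>
  also have "\<dots> = (\<Sum>i=1..n. \<Sum>\<sigma> | \<sigma> \<in> ?P \<and> \<sigma> 1 = i.
      (if \<sigma> 1 < j then t else 1) * t ^ card (descents n \<sigma>))"
  proof (rule sum.group[symmetric, OF fin])
    show "(\<lambda>\<sigma>. \<sigma> 1) ` ?P \<subseteq> {1..n}"
      using permutes_in_image[of _ "{1..n}" 1] n by auto
  qed simp
  also have "\<dots> = (\<Sum>i=1..n. (if i < j then t else 1) * descent_poly t n i)"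
    by (intro sum.cong) (auto simp: descent_poly_def sum_distrib_left)
  finally show ?thesis .
qed

lemma descent_poly_1_1: "descent_poly t 1 1 = 1"
proof -
  have "{\<pi>. \<pi> permutes {1..1::nat} \<and> \<pi> 1 = 1} = {id}"
    by auto
  then show ?thesis
    by (simp add: descent_poly_def descents_def)
qed

text \<open>Passing from \<open>j\<close> to \<open>Suc j\<close> in \<open>descent_poly_Suc\<close>
  changes only the weight of the summand \<open>i = j\<close>, from 1 to \<open>t\<close>.\<close>

lemma descent_poly_diff:
  fixes t :: "'a::comm_ring_1"
  assumes j: "1 \<le> j" "j \<le> n"
  shows "descent_poly t (Suc n) (Suc j) = descent_poly t (Suc n) j + (t - 1) * descent_poly t n j"
proof -
  have "descent_poly t (Suc n) (Suc j) - descent_poly t (Suc n) j =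
      (\<Sum>i=1..n. if i = j then (t - 1) * descent_poly t n i else 0)"
  proof -
    have "descent_poly t (Suc n) (Suc j) - descent_poly t (Suc n) j =
        (\<Sum>i=1..n. (if i < Suc j then t else 1) * descent_poly t n i -
          (if i < j then t else 1) * descent_poly t n i)"
      using j by (simp add: descent_poly_Suc sum_subtractf)
    also have "\<dots> = (\<Sum>i=1..n. if i = j then (t - 1) * descent_poly t n i else 0)"
      by (intro sum.cong) (auto simp: algebra_simps)
    finally show ?thesis .
  qed
  also have "\<dots> = (t - 1) * descent_poly t n j"
    using j by simp
  finally show ?thesis
    by (simp add: algebra_simps)
qed

text \<open>In \<open>descent_poly_Suc\<close> all weights are \<open>t\<close> for the largest
  first letter and 1 for the smallest.\<close>

lemma descent_poly_last:
  fixes t :: "'a::comm_ring_1"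
  assumes "n \<ge> 1"
  shows "descent_poly t (Suc n) (Suc n) = t * descent_poly t (Suc n) 1"
  using assms by (simp add: descent_poly_Suc sum_distrib_left)

text \<open>Iterates \<open>descent_poly_diff\<close> down to first letter 1, with Pascal's rule
  collecting the terms. The induction hypothesis is used at both \<open>Suc b\<close> and
  \<open>b\<close>, so \<open>b\<close> must be arbitrary.\<close>

lemma descent_poly_binomial:
  fixes t :: "'a::comm_ring_1"
  shows "descent_poly t (Suc (a + b)) (Suc a) =
    (\<Sum>k\<le>a. of_nat (a choose k) * (t - 1) ^ k * descent_poly t (Suc (a + b - k)) 1)"
proof (induction a arbitrary: b)
  case 0
  then show ?case by simp
next
  case (Suc a)
  let ?H = "\<lambda>n. descent_poly t (Suc n) 1"
  have "descent_poly t (Suc (Suc a + b)) (Suc (Suc a)) =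
      descent_poly t (Suc (a + Suc b)) (Suc a) + (t - 1) * descent_poly t (Suc (a + b)) (Suc a)"
    using descent_poly_diff[of "Suc a" "Suc (a + b)" t] by simp
  also have "\<dots> = (\<Sum>k\<le>a. of_nat (a choose k) * (t - 1) ^ k * ?H (a + Suc b - k)) +
      (\<Sum>k\<le>a. of_nat (a choose k) * (t - 1) ^ Suc k * ?H (a + b - k))"
    unfolding Suc.IH by (simp add: sum_distrib_left algebra_simps)
  \<comment> \<open>The added term is zero; it allows the index to be shifted so that both sums
    carry the same power of \<open>t - 1\<close>.\<close>
  also have "(\<Sum>k\<le>a. of_nat (a choose k) * (t - 1) ^ k * ?H (a + Suc b - k)) =
      (\<Sum>k\<le>Suc a. of_nat (a choose k) * (t - 1) ^ k * ?H (a + Suc b - k))"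
    by (simp add: binomial_eq_0)
  also have "\<dots> = ?H (Suc a + b) +
      (\<Sum>k\<le>a. of_nat (a choose Suc k) * (t - 1) ^ Suc k * ?H (a + b - k))"
    by (subst sum.atMost_Suc_shift) simp
  also have "\<dots> + (\<Sum>k\<le>a. of_nat (a choose k) * (t - 1) ^ Suc k * ?H (a + b - k)) =
      ?H (Suc a + b) + (\<Sum>k\<le>a. of_nat (Suc a choose Suc k) * (t - 1) ^ Suc k * ?H (a + b - k))"
    by (simp only: binomial_Suc_Suc of_nat_add distrib_right sum.distrib add_ac)
  also have "\<dots> = (\<Sum>k\<le>Suc a. of_nat (Suc a choose k) * (t - 1) ^ k * ?H (Suc a + b - k))"
    by (subst sum.atMost_Suc_shift) simp
  finally show ?case .
qed

text \<open>Groups the permutations by number of descents; \<open>card_descents_less\<close> shows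
  that \<open>d < n\<close> covers them all.\<close>

lemma sum_A_num:
  fixes t :: "'a::comm_ring_1"
  assumes j: "1 \<le> j" "j \<le> n"
  shows "(\<Sum>d<n. of_nat (A_num n d j) * t ^ d) = descent_poly t n j"
proof -
  let ?P = "{\<pi>. \<pi> permutes {1..n} \<and> \<pi> 1 = j}"
  have fin: "finite ?P"
    by (rule finite_subset[of _ "{\<pi>. \<pi> permutes {1..n}}"]) (auto simp: finite_permutations)
  have "descent_poly t n j =
      (\<Sum>d<n. \<Sum>\<pi> | \<pi> \<in> ?P \<and> card (descents n \<pi>) = d. t ^ card (descents n \<pi>))"
    unfolding descent_poly_def
    by (rule sum.group[symmetric, OF fin]) (use j card_descents_less in auto)
  also have "\<dots> = (\<Sum>d<n. of_nat (A_num n d j) * t ^ d)"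
  proof (rule sum.cong[OF refl])
    fix d assume "d \<in> {..<n}"
    then have "A_num n d j = card {\<pi> \<in> ?P. card (descents n \<pi>) = d}"
      using j by (auto simp: A_num_def intro!: arg_cong[of _ _ card])
    then show "(\<Sum>\<pi> | \<pi> \<in> ?P \<and> card (descents n \<pi>) = d. t ^ card (descents n \<pi>)) =
        of_nat (A_num n d j) * t ^ d"
      by simp
  qed
  finally show ?thesis by simp
qed

section \<open>Factorials in Q(t), exponential series and the series H\<close>

lemma of_nat_ratfun_eq_0_iff: "(of_nat n :: ratfun) = 0 \<longleftrightarrow> n = 0"
  by (simp add: of_nat_fract flip: to_fract_def)

lemma binomial_div_fact:
  assumes "k \<le> n"
  shows "of_nat (n choose k) / of_nat (fact n) = (1 / of_nat (fact k * fact (n - k)) :: ratfun)"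
proof -
  have "of_nat (fact k * fact (n - k)) * of_nat (n choose k) = (of_nat (fact n) :: ratfun)"
    using binomial_fact_lemma[OF assms] by (metis of_nat_mult)
  then show ?thesis
    by (simp add: field_simps of_nat_ratfun_eq_0_iff del: of_nat_mult of_nat_fact)
qed

text \<open>Substituting a multiple of x scales the n-th coefficient by \<open>c ^ n\<close>. Both
  exponents in the theorem have this form, with \<open>c\<close> a series in y.\<close>

lemma exp_series_linear:
  "exp_series (fps_const c * fps_X) = Abs_fps (\<lambda>n. c ^ n * fps_const (1 / of_nat (fact n)))"
  unfolding exp_series_def by (subst fps_compose_linear) simp

lemma fps_const_mult_collect:
  fixes x y :: "'a::field fps"
  shows "fps_const p * x * fps_const (1 / a) * (fps_const (h / b) * y) =
    fps_const (p * h / (a * b)) * (x * y)"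
proof -
  have "fps_const (p * h / (a * b)) = fps_const p * fps_const (1 / a) * fps_const (h / b)"
    by simp
  then show ?thesis
    by (simp only: mult_ac)
qed

lemma fps_const_sum: "fps_const (sum f A) = (\<Sum>x\<in>A. fps_const (f x))"
  by (rule fps_ext) (simp add: fps_sum_nth)

lemma one_plus_fps_X_power_nth:
  "((1 + fps_X) ^ n :: 'a::comm_ring_1 fps) $ i = of_nat (n choose i)"
proof (induction n arbitrary: i)
  case 0
  then show ?case by (cases i) simp_all
next
  case (Suc n)
  then show ?case by (cases i) (simp_all add: distrib_right)
qed

text \<open>This is \<open>H(x(1+y))\<close> of the overview, expanded in powers of x.\<close>

definition first_letter_1_gf :: series where
  "first_letter_1_gf = Abs_fps (\<lambda>m.
     fps_const (descent_poly t_ratfun (Suc m) 1 / of_nat (fact m)) * (1 + fps_X) ^ m)"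

text \<open>The parameter \<open>z\<close> serves two cases: y for the numerator and 1 + y for the
  denominator.\<close>

lemma exp_series_times_first_letter_1_gf_nth:
  "(exp_series (fps_const (fps_const c * z) * fps_X) * first_letter_1_gf) $ m =
    (\<Sum>k\<le>m. fps_const (c ^ k * descent_poly t_ratfun (Suc (m - k)) 1 / of_nat (fact k * fact (m - k))) *
      (z ^ k * (1 + fps_X) ^ (m - k)))"
  unfolding fps_mult_nth exp_series_linear first_letter_1_gf_def fps_nth_Abs_fps
    power_mult_distrib fps_const_power atLeast0AtMost fps_const_mult_collect of_nat_mult ..

section \<open>Factorisation of A and the equation for H\<close>

lemma A_gf_nth_Suc:
  "A_gf $ Suc m = (\<Sum>a\<le>m. fps_const (descent_poly t_ratfun (Suc m) (Suc a)
     / of_nat (fact a * fact (m - a))) * fps_X ^ Suc a)"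
proof -
  have "A_gf $ Suc m = (\<Sum>j=1..Suc m. \<Sum>d<Suc m. fps_const (of_nat (A_num (Suc m) d j) * t_ratfun ^ d
      / of_nat (fact (j - 1) * fact (Suc m - j))) * fps_X ^ j)"
    unfolding A_gf_def fps_nth_Abs_fps by (rule sum.swap)
  also have "\<dots> = (\<Sum>j=1..Suc m. fps_const (descent_poly t_ratfun (Suc m) j
      / of_nat (fact (j - 1) * fact (Suc m - j))) * fps_X ^ j)"
  proof (rule sum.cong[OF refl])
    fix j assume "j \<in> {1..Suc m}"
    then show "(\<Sum>d<Suc m. fps_const (of_nat (A_num (Suc m) d j) * t_ratfun ^ d
        / of_nat (fact (j - 1) * fact (Suc m - j))) * fps_X ^ j) =
      fps_const (descent_poly t_ratfun (Suc m) j
        / of_nat (fact (j - 1) * fact (Suc m - j))) * fps_X ^ j"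
      using sum_A_num[of j "Suc m" t_ratfun]
      by (simp only: flip: fps_const_sum sum_distrib_right sum_divide_distrib) simp
  qed
  also have "\<dots> = (\<Sum>a\<le>m. fps_const (descent_poly t_ratfun (Suc m) (Suc a)
     / of_nat (fact a * fact (m - a))) * fps_X ^ Suc a)"
    by (rule sum.reindex_bij_witness[of _ Suc "\<lambda>j. j - 1"]) auto
  finally show ?thesis .
qed

text \<open>Both sides equal \<open>1 / (k! (a-k)! (m-a)!)\<close>.\<close>

lemma fact_binomial_exchange:
  assumes "k \<le> a" "a \<le> m"
  shows "of_nat (a choose k) / of_nat (fact a * fact (m - a)) =
    (of_nat ((m - k) choose (a - k)) / of_nat (fact k * fact (m - k)) :: ratfun)"
proof -
  have "of_nat (a choose k) / of_nat (fact a * fact (m - a)) =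
      (of_nat (a choose k) / of_nat (fact a) / of_nat (fact (m - a)) :: ratfun)"
    by simp
  also have "\<dots> = 1 / of_nat (fact (a - k) * fact (m - a)) / of_nat (fact k)"
    using assms by (subst binomial_div_fact) simp_all
  also have "1 / of_nat (fact (a - k) * fact (m - a)) =
      (of_nat ((m - k) choose (a - k)) / of_nat (fact (m - k)) :: ratfun)"
    using assms binomial_div_fact[of "a - k" "m - k"] by simp
  finally show ?thesis
    by simp
qed

text \<open>After the factor xy is removed, the coefficients of x^m y^a agree by
  \<open>descent_poly_binomial\<close>, once \<open>fact_binomial_exchange\<close> has put them in
  the form of the Cauchy product.\<close>

lemma A_gf_eq:
  "A_gf = X * Y * exp_series ((T - 1) * X * Y) * first_letter_1_gf"
proof (rule fps_ext)
  fix n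
  let ?t = t_ratfun
  let ?H = "\<lambda>m. descent_poly ?t (Suc m) 1"
  let ?E = "exp_series (fps_const (fps_const (?t - 1) * fps_X) * fps_X)"
  have lin: "(T - 1) * X * Y = fps_const (fps_const (?t - 1) * fps_X) * fps_X"
    by (simp add: T_def X_def Y_def algebra_simps flip: fps_const_sub fps_const_mult)
  have rhs: "X * Y * ?E * first_letter_1_gf =
      fps_X * (fps_const fps_X * (?E * first_letter_1_gf))"
    by (simp add: X_def Y_def algebra_simps)
  show "A_gf $ n = (X * Y * exp_series ((T - 1) * X * Y) * first_letter_1_gf) $ n"
  proof (cases n)
    case 0
    then show ?thesis
      by (simp add: A_gf_def X_def)
  next
    case (Suc m)
    have "(\<Sum>a\<le>m. fps_const (descent_poly ?t (Suc m) (Suc a) / of_nat (fact a * fact (m - a))) * fps_X ^ a)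
        = (?E * first_letter_1_gf) $ m" (is "?L = ?R")
    proof (rule fps_ext)
      fix a
      have R: "?R $ a = (\<Sum>k\<le>m. if k \<le> a then (?t - 1) ^ k * ?H (m - k) *
          (of_nat ((m - k) choose (a - k)) / of_nat (fact k * fact (m - k))) else 0)"
        unfolding exp_series_times_first_letter_1_gf_nth fps_sum_nth
        by (intro sum.cong) (simp_all add: fps_X_power_mult_nth one_plus_fps_X_power_nth)
      have L: "?L $ a = (if a \<le> m then descent_poly ?t (Suc m) (Suc a)
          / of_nat (fact a * fact (m - a)) else 0)"
        by (simp add: fps_sum_nth mult_delta_right del: of_nat_mult of_nat_fact cong: if_cong)
      show "?L $ a = ?R $ a"
      proof (cases "a \<le> m")
        case True
        have "descent_poly ?t (Suc m) (Suc a) =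
            (\<Sum>k\<le>a. of_nat (a choose k) * (?t - 1) ^ k * ?H (m - k))"
          using descent_poly_binomial[of ?t a "m - a"] True by simp
        then have "?L $ a = (\<Sum>k\<le>a. (?t - 1) ^ k * ?H (m - k) *
            (of_nat (a choose k) / of_nat (fact a * fact (m - a))))"
          using True by (simp only: L if_True sum_divide_distrib) (simp add: mult_ac)
        also have "\<dots> = (\<Sum>k\<le>a. (?t - 1) ^ k * ?H (m - k) *
            (of_nat ((m - k) choose (a - k)) / of_nat (fact k * fact (m - k))))"
          by (intro sum.cong refl) (simp only: fact_binomial_exchange[OF _ True] atMost_iff)
        also have "\<dots> = ?R $ a"
          unfolding R by (rule sum.mono_neutral_cong_left) (use True in auto)
        finally show ?thesis .
      next
        \<comment> \<open>For \<open>a > m\<close> the right-hand coefficient vanishes too, since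
          \<open>a - k > m - k\<close> whenever \<open>k \<le> m\<close>.\<close>
        case False
        then show ?thesis
          unfolding L R by (auto intro!: sum.neutral[symmetric] simp: binomial_eq_0)
      qed
    qed
    moreover have "A_gf $ Suc m = fps_X * ?L"
      unfolding A_gf_nth_Suc sum_distrib_left by (intro sum.cong) (simp_all add: mult_ac)
    ultimately show ?thesis
      unfolding lin rhs Suc by simp
  qed
qed

text \<open>With \<open>z\<close> = 1 + y every term of the Cauchy product carries the same power (1
  + y)^m. The scalars then sum to \<open>f(m+1,m+1) / m!\<close> by
  \<open>descent_poly_binomial\<close> with \<open>b = 0\<close>.\<close>

lemma first_letter_1_gf_denominator:
  "first_letter_1_gf * (T - exp_series ((T - 1) * X * (1 + Y))) = T - 1"
proof (rule fps_ext)
  fix m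
  let ?t = t_ratfun
  let ?H = "\<lambda>m. descent_poly ?t (Suc m) 1"
  let ?E = "exp_series (fps_const (fps_const (?t - 1) * (1 + fps_X)) * fps_X)"
  have lin: "(T - 1) * X * (1 + Y) = fps_const (fps_const (?t - 1) * (1 + fps_X)) * fps_X"
    by (simp add: T_def X_def Y_def algebra_simps flip: fps_const_sub fps_const_mult fps_const_add)
  have "(?E * first_letter_1_gf) $ m =
      (\<Sum>k\<le>m. fps_const ((?t - 1) ^ k * ?H (m - k) * (1 / of_nat (fact k * fact (m - k)))) * (1 + fps_X) ^ m)"
    unfolding exp_series_times_first_letter_1_gf_nth
    by (intro sum.cong) (simp_all flip: power_add)
  also have "\<dots> = fps_const (\<Sum>k\<le>m. (?t - 1) ^ k * ?H (m - k) *
      (of_nat (m choose k) / of_nat (fact m))) * (1 + fps_X) ^ m"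
    unfolding sum_distrib_right[symmetric] fps_const_sum
    by (intro arg_cong2[where f = "(*)"] sum.cong refl) (simp only: binomial_div_fact atMost_iff)
  also have "(\<Sum>k\<le>m. (?t - 1) ^ k * ?H (m - k) * (of_nat (m choose k) / of_nat (fact m))) =
      descent_poly ?t (Suc m) (Suc m) / of_nat (fact m)"
    using descent_poly_binomial[of ?t m 0] by (simp add: sum_divide_distrib mult_ac)
  finally have E: "(?E * first_letter_1_gf) $ m =
      fps_const (descent_poly ?t (Suc m) (Suc m) / of_nat (fact m)) * (1 + fps_X) ^ m" .
  have TH: "(T * first_letter_1_gf) $ m = fps_const (?t * ?H m / of_nat (fact m)) * (1 + fps_X) ^ m"
    by (simp add: T_def first_letter_1_gf_def flip: mult.assoc)
  have "first_letter_1_gf * (T - ?E) = T * first_letter_1_gf - ?E * first_letter_1_gf"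
    by (simp add: algebra_simps)
  then have "(first_letter_1_gf * (T - ?E)) $ m =
      fps_const (?t * ?H m / of_nat (fact m)) * (1 + fps_X) ^ m -
      fps_const (descent_poly ?t (Suc m) (Suc m) / of_nat (fact m)) * (1 + fps_X) ^ m"
    by (simp only: fps_sub_nth E TH)
  also have "\<dots> = (T - 1) $ m"
  \<comment> \<open>For positive \<open>m\<close> the two terms cancel by
    \<open>descent_poly_last\<close>; that relation fails at length 1, where
    \<open>f(1,1) = 1\<close> leaves \<open>t - 1\<close>.\<close>
  proof (cases "m = 0")
    case True
    then show ?thesis
      using descent_poly_1_1[of ?t] by (simp add: T_def)
  next
    case False
    then show ?thesis
      using descent_poly_last[of m ?t] by (simp add: T_def)
  qed
  finally show "(first_letter_1_gf * (T - exp_series ((T - 1) * X * (1 + Y)))) $ m = (T - 1) $ m"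
    unfolding lin .
qed

theorem theorem2p2:
  "A_gf = ((T - 1) * X * Y * exp_series ((T - 1) * X * Y)) / (T - exp_series ((T - 1) * X * (1 + Y)))"
proof -
  let ?D = "T - exp_series ((T - 1) * X * (1 + Y))"
  let ?N = "(T - 1) * X * Y * exp_series ((T - 1) * X * Y)"
  \<comment> \<open>The ring of series is an integral domain, so a nonzero \<open>?D\<close> can be
    cancelled and it suffices to compare both sides after multiplication by
    \<open>?D\<close>.\<close>
  have "?D $ 0 \<noteq> 0"
    using t_ratfun_neq_1 by (simp only: denominator_nth_0) simp
  then have "?D \<noteq> 0"
    by auto
  have "A_gf * ?D = X * Y * exp_series ((T - 1) * X * Y) * (first_letter_1_gf * ?D)"
    unfolding A_gf_eq by (rule mult.assoc)
  also have "\<dots> = ?N"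
    unfolding first_letter_1_gf_denominator by (simp only: mult_ac)
  also have "\<dots> = ?N / ?D * ?D"
    by (rule divide_denominator_mult[symmetric])
  finally show ?thesis
    using \<open>?D \<noteq> 0\<close> by (simp only: mult_cancel_right) simp
qed

end
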